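(* Let $d\ge 1$ and $n\ge 0$ be fixed integers. The polynomial sequence $\big(H^{(d)}_q(n,k)\big)_{0\le k\le n}$ is $q$-log-concave; that is, for all $1\le k\le n-1$ the polynomial $H^{(d)}_q(n,k)^2-H^{(d)}_q(n,k-1)\,H^{(d)}_q(n,k+1)$ in $q$ has only nonnegative coefficients.
   Context: For $d\ge1$ and $0\le k\le n$ the $q$-analogue of the $d$-Hoggatt number is $$H^{(d)}_q(n,k)=q^{\frac{dk(k-1)}{2}}\prod_{j=0}^{d-1}\frac{\begin{bmatrix} n+j\\ k\end{bmatrix}_q}{\begin{bmatrix} k+j\\ k\end{bmatrix}_q},$$ where $[m]_q=\frac{1-q^m}{1-q}$, $[m]_q!=[1]_q[2]_q\cdots[m]_q$ and $\begin{bmatrix} n\\ k\end{bmatrix}_q=\frac{[n]_q!}{[k]_q!\,[n-k]_q!}$. It is a polynomial in $q$. A sequence of real polynomials $(f_k(q))$ is $q$-log-concave if $f_k(q)^2-f_{k-1}(q)f_{k+1}(q)$ has only nonnegative coefficients for every interior index $k$. *)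

theory Defs
  imports "HOL-Computational_Algebra.Computational_Algebra" "HOL-Computational_Algebra.Field_as_Ring"
begin

section \<open>\<open>q\<close>-analogues in the field of rational functions \<open>\<real>(q)\<close>\<close>

definition qvar :: "real poly fract" where
  "qvar = to_fract [:0, 1:]"

definition qint :: "nat \<Rightarrow> real poly fract" where
  "qint m = (1 - qvar ^ m) / (1 - qvar)"

definition qfact :: "nat \<Rightarrow> real poly fract" where
  "qfact m = (\<Prod>i=1..m. qint i)"

text \<open>Only meaningful for \<open>k \<le> n\<close>, because of the truncated subtraction.\<close>

definition qbinom :: "nat \<Rightarrow> nat \<Rightarrow> real poly fract" where
  "qbinom n k = qfact n / (qfact k * qfact (n - k))"

definition hoggatt_fract :: "nat \<Rightarrow> nat \<Rightarrow> nat \<Rightarrow> real poly fract" where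
  "hoggatt_fract d n k =
     qvar ^ (d * k * (k - 1) div 2) * (\<Prod>j=0..<d. qbinom (n + j) k / qbinom (k + j) k)"

text \<open>
  For \<open>k \<le> n\<close> the rational function above is a polynomial, and the following is that
  polynomial; see \<open>to_fract_hoggatt\<close> below.
\<close>

definition hoggatt :: "nat \<Rightarrow> nat \<Rightarrow> nat \<Rightarrow> real poly" where
  "hoggatt d n k = (THE p. to_fract p = hoggatt_fract d n k)"

text \<open>\<open>q\<close>-log-concavity of the finite sequence \<open>f 0, \<dots>, f n\<close>.\<close>

definition q_log_concave :: "nat \<Rightarrow> (nat \<Rightarrow> real poly) \<Rightarrow> bool" where
  "q_log_concave n f \<longleftrightarrow>
     (\<forall>k. 1 \<le> k \<and> k < n \<longrightarrow>
       (\<forall>i. coeff (f k ^ 2 - f (k - 1) * f (k + 1)) i \<ge> 0))"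


section \<open>Well-definedness of \<^const>\<open>hoggatt\<close>\<close>

text \<open>
  After cancellation, the product in \<^const>\<open>hoggatt_fract\<close> becomes a quotient of products of
  polynomials \<open>1 - q^N\<close>. Divisibility is checked at each prime \<open>p\<close> of \<open>\<real>[q]\<close>: the multiplicity
  of \<open>p\<close> in \<open>1 - q^N\<close> is \<open>1\<close> or \<open>0\<close>, according to whether a fixed \<open>m\<close> divides \<open>N\<close> or not.
\<close>

definition xpoly :: "nat \<Rightarrow> real poly" where
  "xpoly N = 1 - [:0, 1:] ^ N"

lemma xpoly_nz: "N > 0 \<Longrightarrow> xpoly N \<noteq> 0"
proof
  assume "N > 0" "xpoly N = 0"
  hence "poly (xpoly N) 0 = 0" by simp
  thus False using \<open>N > 0\<close> by (simp add: xpoly_def poly_power power_0_left)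
qed

lemma xpoly_not_sq_dvd:
  assumes "prime_elem p" "N > 0"
  shows "\<not> p ^ 2 dvd xpoly N"
proof
  assume "p ^ 2 dvd xpoly N"
  then obtain r where r: "xpoly N = p ^ 2 * r" by (elim dvdE)
  have "pderiv (xpoly N) = - smult (of_nat N) ([:0, 1:] ^ (N - 1))"
    by (simp add: xpoly_def pderiv_diff pderiv_power pderiv_1 pderiv_pCons)
  moreover have "p dvd pderiv (xpoly N)"
    unfolding r by (simp add: pderiv_mult power2_eq_square)
  ultimately have "p dvd [:0, 1:] ^ (N - 1)"
    using assms(2) by (simp add: dvd_smult_iff)
  hence "p dvd [:0, 1:] ^ N"
    using assms(2) by (metis Suc_diff_1 dvd_mult power_Suc)
  moreover have "p dvd xpoly N" using r by (simp add: power2_eq_square)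
  ultimately have "p dvd xpoly N + [:0, 1:] ^ N" by (rule dvd_add[rotated])
  hence "p dvd 1" by (simp add: xpoly_def)
  thus False using assms(1) by (simp add: prime_elem_def)
qed

lemma dvd_xpoly_add:
  assumes "p dvd xpoly M"
  shows "p dvd xpoly (M + N) \<longleftrightarrow> p dvd xpoly N"
proof -
  have "xpoly (M + N) = xpoly N + [:0, 1:] ^ N * xpoly M"
    by (simp add: xpoly_def power_add algebra_simps)
  thus ?thesis using assms by (metis dvd_add_left_iff dvd_mult)
qed

lemma dvd_xpoly_mod:
  assumes "p dvd xpoly M"
  shows "p dvd xpoly N \<longleftrightarrow> p dvd xpoly (N mod M)"
proof -
  have "p dvd xpoly (k * M + r) \<longleftrightarrow> p dvd xpoly r" for k r
    using dvd_xpoly_add[OF assms] by (induction k) (simp_all add: add.assoc)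
  from this[of "N div M" "N mod M"] show ?thesis by simp
qed

lemma multiplicity_xpoly:
  assumes "prime_elem p"
  obtains m where "\<And>N. N > 0 \<Longrightarrow> multiplicity p (xpoly N) = (if m dvd N then 1 else 0)"
proof -
  have *: "multiplicity p (xpoly N) = (if p dvd xpoly N then 1 else 0)" if "N > 0" for N
  proof (cases "p dvd xpoly N")
    case True
    thus ?thesis using xpoly_not_sq_dvd[OF assms that]
      by (auto intro!: multiplicity_eqI simp: numeral_2_eq_2)
  qed (simp add: not_dvd_imp_multiplicity_0)
  show ?thesis
  proof (cases "\<exists>N>0. p dvd xpoly N")
    case False
    have "multiplicity p (xpoly N) = (if 0 dvd N then 1 else 0)" if "N > 0" for N
    proof -
      have "\<not> p dvd xpoly N" using False that by blast
      thus ?thesis using *[OF that] that by simp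
    qed
    thus ?thesis by (rule that)
  next
    case True
    define m where "m = (LEAST N. N > 0 \<and> p dvd xpoly N)"
    have m: "m > 0 \<and> p dvd xpoly m"
      unfolding m_def using True by (rule LeastI_ex)
    have "p dvd xpoly N \<longleftrightarrow> m dvd N" for N
    proof -
      have "p dvd xpoly (N mod m) \<longleftrightarrow> N mod m = 0"
      proof
        assume "p dvd xpoly (N mod m)"
        moreover have "N mod m < m" using m by simp
        ultimately show "N mod m = 0"
          using not_less_Least[of "N mod m" "\<lambda>N. N > 0 \<and> p dvd xpoly N"] unfolding m_def
          by auto
      qed (simp add: xpoly_def)
      thus ?thesis using dvd_xpoly_mod[of p m N] m by (simp add: dvd_eq_mod_eq_0)
    qed
    thus ?thesis using * by (intro that[of m]) simp
  qed
qed

lemma sum_dvd_count: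
  fixes m b k :: nat
  assumes "m > 0"
  shows "(\<Sum>i=1..k. if m dvd b + i then 1 else 0) + b div m = (b + k) div m"
proof (induction k)
  case (Suc k)
  have "(b + Suc k) div m = (b + k) div m + (if m dvd b + Suc k then 1 else 0)"
    using div_Suc[of "b + k" m] by (auto simp: dvd_eq_mod_eq_0)
  thus ?case using Suc by simp
qed simp

lemma sum_mod_less:
  fixes m c t :: nat
  assumes "m > 0" "c \<le> m"
  shows "(\<Sum>j<t. if j mod m < c then 1 else 0) = (t div m) * c + min (t mod m) c"
proof (induction t)
  case (Suc t)
  show ?case
  proof (cases "Suc t mod m = 0")
    case True
    hence "Suc (t mod m) = m" by (simp add: mod_Suc split: if_splits)
    thus ?thesis using Suc True assms by (auto simp: div_Suc min_def)
  next
    case False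
    hence "Suc t mod m = Suc (t mod m)" by (simp add: mod_Suc split: if_splits)
    thus ?thesis using Suc False assms by (auto simp: div_Suc min_def)
  qed
qed simp

lemma add_div_eq_1: "x < m \<Longrightarrow> y < m \<Longrightarrow> \<not> x + y < m \<Longrightarrow> (x + y) div m = (1::nat)"
  by (intro div_nat_eqI) auto

lemma sum_mod_less_shift:
  fixes m c a d :: nat
  assumes "m > 0" "c \<le> m"
  shows "(\<Sum>j<d. if (a + j) mod m < c then 1 else 0) \<le> (\<Sum>j<d. if j mod m < c then 1 else (0::nat))"
proof -
  let ?P = "\<lambda>t. (\<Sum>j<t. if j mod m < c then 1 else (0::nat))"
  have "?P (a + d) = ?P a + (\<Sum>j<d. if (a + j) mod m < c then 1 else 0)"
    by (induction d) auto
  moreover have "?P (a + d) \<le> ?P a + ?P d"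
  proof -
    define x y where "x = a mod m" and "y = d mod m"
    have xy: "x < m" "y < m" using assms by (auto simp: x_def y_def)
    have D: "(a + d) div m = a div m + d div m + (x + y) div m"
      unfolding x_def y_def by (rule div_add1_eq)
    have M: "(a + d) mod m = (x + y) mod m"
      unfolding x_def y_def by (rule mod_add_eq[symmetric])
    have "(x + y) div m * c + min ((x + y) mod m) c \<le> min x c + min y c"
    proof (cases "x + y < m")
      case False
      have "(x + y) mod m = x + y - m" using xy False by (simp add: le_mod_geq)
      moreover have "c + min (x + y - m) c \<le> min x c + min y c"
        using xy False assms(2) by linarith
      ultimately show ?thesis using add_div_eq_1[OF xy False] by simp
    qed (simp add: min_def)
    thus ?thesis unfolding sum_mod_less[OF assms] D M x_def[symmetric] y_def[symmetric]
      by (simp add: add_mult_distrib)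
  qed
  ultimately show ?thesis by linarith
qed

lemma sum_dvd_shift:
  fixes m a d k :: nat
  shows "(\<Sum>j<d. \<Sum>i=1..k. if m dvd j + i then 1 else 0)
       \<le> (\<Sum>j<d. \<Sum>i=1..k. if m dvd a + j + i then 1 else (0::nat))"
proof (cases "m = 0")
  case False
  define c where "c = m - k mod m"
  have c: "c \<le> m" by (simp add: c_def)
  have *: "(\<Sum>i=1..k. if m dvd b + i then 1 else 0) + (if b mod m < c then 1 else 0)
             = k div m + (1::nat)" for b
  proof -
    have "(b + k) div m = b div m + k div m + (b mod m + k mod m) div m"
      by (rule div_add1_eq)
    moreover have "(b mod m + k mod m) div m + (if b mod m < c then 1 else 0) = 1"
    proof (cases "b mod m + k mod m < m")
      case False
      moreover have "b mod m < m" "k mod m < m" using \<open>m \<noteq> 0\<close> by auto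
      ultimately have "(b mod m + k mod m) div m = 1"
        using \<open>\<not> b mod m + k mod m < m\<close> by (intro add_div_eq_1)
      thus ?thesis using False by (simp add: c_def)
    qed (simp add: c_def)
    ultimately show ?thesis using sum_dvd_count[of m b k] \<open>m \<noteq> 0\<close> by linarith
  qed
  have tot: "(\<Sum>j<d. \<Sum>i=1..k. if m dvd h j + i then 1 else 0)
          + (\<Sum>j<d. if h j mod m < c then 1 else 0) = d * (k div m + (1::nat))" for h
    unfolding sum.distrib[symmetric] * by simp
  show ?thesis
    using tot[of "\<lambda>j. j"] tot[of "\<lambda>j. a + j"] sum_mod_less_shift[of m c a d] False c by linarith
qed simp

lemma xpoly_prod_dvd:
  "(\<Prod>j<d. \<Prod>i=1..k. xpoly (j + i)) dvd (\<Prod>j<d. \<Prod>i=1..k. xpoly (a + j + i))"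
proof (rule multiplicity_le_imp_dvd)
  show "(\<Prod>j<d. \<Prod>i=1..k. xpoly (j + i)) \<noteq> 0"
    by (auto simp: xpoly_nz)
next
  fix p :: "real poly" assume "prime p"
  hence p: "prime_elem p" by auto
  obtain m where m: "\<And>N. N > 0 \<Longrightarrow> multiplicity p (xpoly N) = (if m dvd N then 1 else 0)"
    using multiplicity_xpoly[OF p] by blast
  have *: "multiplicity p (\<Prod>j<d. \<Prod>i=1..k. xpoly (h j + i))
          = (\<Sum>j<d. \<Sum>i=1..k. if m dvd h j + i then 1 else 0)" for h
  proof -
    have "multiplicity p (\<Prod>j<d. \<Prod>i=1..k. xpoly (h j + i))
            = (\<Sum>j<d. multiplicity p (\<Prod>i=1..k. xpoly (h j + i)))"
      by (rule prime_elem_multiplicity_prod_distrib[OF p]) (auto simp: xpoly_nz)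
    also have "\<dots> = (\<Sum>j<d. \<Sum>i=1..k. multiplicity p (xpoly (h j + i)))"
      by (intro sum.cong prime_elem_multiplicity_prod_distrib[OF p] refl)
         (auto simp: xpoly_nz)
    also have "\<dots> = (\<Sum>j<d. \<Sum>i=1..k. if m dvd h j + i then 1 else 0)"
      by (intro sum.cong refl m) auto
    finally show ?thesis .
  qed
  show "multiplicity p (\<Prod>j<d. \<Prod>i=1..k. xpoly (j + i))
      \<le> multiplicity p (\<Prod>j<d. \<Prod>i=1..k. xpoly (a + j + i))"
    using *[of "\<lambda>j. j"] *[of "\<lambda>j. a + j"] sum_dvd_shift[of m k d a] by simp
qed

lemma to_fract_power: "to_fract (x ^ n) = to_fract x ^ n"
  by (induction n) simp_all

lemma to_fract_prod: "to_fract (prod f A) = (\<Prod>x\<in>A. to_fract (f x))"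
  by (induction A rule: infinite_finite_induct) simp_all

lemma qint_eq: "qint m = to_fract (xpoly m) / to_fract (xpoly 1)"
  by (simp add: qint_def qvar_def xpoly_def to_fract_power)

lemma qint_nz: "m > 0 \<Longrightarrow> qint m \<noteq> 0"
  by (simp add: qint_eq xpoly_nz)

lemma qfact_nz: "qfact m \<noteq> 0"
  by (simp add: qfact_def qint_nz)

lemma qfact_add: "qfact (b + k) = qfact b * (\<Prod>i=1..k. qint (b + i))"
  by (induction k) (simp_all add: qfact_def mult_ac)

lemma qbinom_add: "qbinom (b + k) k = (\<Prod>i=1..k. qint (b + i)) / qfact k"
  by (simp add: qbinom_def qfact_add qfact_nz)

lemma hoggatt_fract_eq:
  assumes "k \<le> n"
  shows "hoggatt_fract d n k = qvar ^ (d * k * (k - 1) div 2) *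
     (to_fract (\<Prod>j<d. \<Prod>i=1..k. xpoly (n - k + j + i)) /
      to_fract (\<Prod>j<d. \<Prod>i=1..k. xpoly (j + i)))"
proof -
  have "qbinom (n + j) k / qbinom (k + j) k =
      (\<Prod>i=1..k. to_fract (xpoly (n - k + j + i))) / (\<Prod>i=1..k. to_fract (xpoly (j + i)))" for j
  proof -
    have "n + j = (n - k + j) + k" using assms by simp
    hence "qbinom (n + j) k / qbinom (k + j) k =
        (\<Prod>i=1..k. qint (n - k + j + i)) / (\<Prod>i=1..k. qint (j + i))"
      using qbinom_add[of "n - k + j" k] qbinom_add[of j k] 
      by (simp add: qfact_nz add.commute)
    also have "\<dots> = (\<Prod>i=1..k. qint (n - k + j + i) / qint (j + i))"
      by (simp only: prod_dividef)
    also have "\<dots> = (\<Prod>i=1..k. to_fract (xpoly (n - k + j + i)) / to_fract (xpoly (j + i)))"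
      by (simp add: qint_eq xpoly_nz)
    finally show ?thesis by (simp only: prod_dividef)
  qed
  thus ?thesis
    by (simp add: hoggatt_fract_def to_fract_prod prod_dividef atLeast0LessThan)
qed

theorem to_fract_hoggatt:
  assumes "k \<le> n"
  shows "to_fract (hoggatt d n k) = hoggatt_fract d n k"
proof -
  obtain r where r: "(\<Prod>j<d. \<Prod>i=1..k. xpoly (n - k + j + i)) =
      (\<Prod>j<d. \<Prod>i=1..k. xpoly (j + i)) * r"
    using xpoly_prod_dvd[of k d "n - k"] unfolding dvd_def by blast
  have nz: "(\<Prod>j<d. \<Prod>i=1..k. xpoly (j + i)) \<noteq> 0"
    by (auto simp: xpoly_nz)
  have "to_fract ([:0, 1:] ^ (d * k * (k - 1) div 2) * r) = hoggatt_fract d n k"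
    using nz unfolding hoggatt_fract_eq[OF assms] r
    by (simp add: qvar_def to_fract_power del: prod_zero_iff)
  hence "\<exists>!p. to_fract p = hoggatt_fract d n k"
    by (metis to_fract_eq_iff)
  thus ?thesis unfolding hoggatt_def by (rule theI')
qed

end

theory Submission
  imports Defs "Jordan_Normal_Form.Determinant"
begin

text \<open>
  Write \<open>H\<^sub>d(n, k)\<close> for the \<open>d\<close>-Hoggatt polynomial. Its product formula gives it for
  neighbouring parameters as a rational multiple of \<open>H\<^sub>d(n, k)\<close>, and the difference in
  question turns out to be a single product:

  \<open>H\<^sub>d(n, k)\<^sup>2 - H\<^sub>d(n, k - 1) H\<^sub>d(n, k + 1) = H\<^bsub>d - 1\<^esub>(n, k) H\<^bsub>d + 1\<^esub>(n, k)\<close>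

  (\<open>hoggatt_octahedron\<close>). After division by \<open>H\<^sub>d(n, k)\<^sup>2\<close> this is a relation between six
  \<open>q\<close>-integers. Log-concavity thus follows once every \<open>H\<^sub>d(n, k)\<close> is known to have
  nonnegative coefficients (\<open>nonneg_coeffs_hoggatt\<close>), including \<open>d = 0\<close>, where it is \<open>1\<close>.

  For the positivity, \<open>H\<^sub>d(n, k)\<close> is the Schur polynomial of the rectangle with \<open>k\<close> rows and \<open>d\<close>
  columns at \<open>1, q, \<dots>, q\<^bsup>n - 1\<^esup>\<close>. In terms of determinants, let \<open>A(l)\<close> be the \<open>n \<times> n\<close>
  determinant with entries \<open>q\<close> to the power \<open>i * l j\<close>. It is a Vandermonde determinant, and comparison of
  products shows that \<open>H\<^sub>d(n, k)\<close> is the quotient of \<open>A(l)\<close> for the exponents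
  \<open>0, \<dots>, n - k - 1, n - k + d, \<dots>, n + d - 1\<close> by \<open>A(l)\<close> for \<open>0, \<dots>, n - 1\<close>
  (\<open>hoggatt_alternant\<close>). On the other hand, subtracting from each row the preceding one and expanding
  every entry as a geometric sum expresses \<open>A(l)\<close> as \<open>(q - 1) \<dots> (q\<^bsup>n - 1\<^esup> - 1)\<close> times
  a sum of smaller determinants \<open>A(f)\<close> with powers of \<open>q\<close> as coefficients, where \<open>f\<close> ranges over
  the sequences interlacing \<open>l\<close> (\<open>alternant_branching\<close>). By induction \<open>A(l)\<close> is a product
  independent of \<open>l\<close>, times a polynomial with nonnegative coefficients. That product is
  \<open>A(0, \<dots>, n - 1)\<close> up to a power of \<open>q\<close>, so the quotient has nonnegative coefficients too.
\<close>

section \<open>Determinants\<close>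

lemma prod_strict_pairs_shift:
  fixes f :: "nat \<Rightarrow> nat \<Rightarrow> 'a :: comm_monoid_mult"
  shows "(\<Prod>j<Suc n. \<Prod>i<j. f i j) = (\<Prod>j<n. f 0 (Suc j)) * (\<Prod>j<n. \<Prod>i<j. f (Suc i) (Suc j))"
  by (simp add: prod.lessThan_Suc_shift prod.distrib del: prod.lessThan_Suc)

text \<open>
  Subtracting \<open>c\<close> times the preceding row from each row is multiplication by a unitriangular matrix;
  when the first column is geometric with ratio \<open>c\<close>, only its top entry survives. The two uses are
  \<open>c = x 0\<close> for the Vandermonde recursion and \<open>c = 1\<close> for differences of consecutive rows.
\<close>

lemma det_subtract_previous_rows:
  fixes a :: "nat \<Rightarrow> nat \<Rightarrow> 'a :: comm_ring_1"
  assumes "a 0 0 = 1" and col0: "\<And>i. i < n \<Longrightarrow> a (Suc i) 0 = c * a i 0"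
  shows "det (mat (Suc n) (Suc n) (\<lambda>(i, j). a i j)) =
    det (mat n n (\<lambda>(i, j). a (Suc i) (Suc j) - c * a i (Suc j)))"
proof -
  define A where "A = mat (Suc n) (Suc n) (\<lambda>(i, j). a i j)"
  define L where "L = mat (Suc n) (Suc n)
    (\<lambda>(i, j). if j = i then 1 else if Suc j = i then - c else (0 :: 'a))"
  define B where "B = mat n n (\<lambda>(i, j). a (Suc i) (Suc j) - c * a i (Suc j))"
  have carr: "A \<in> carrier_mat (Suc n) (Suc n)" "L \<in> carrier_mat (Suc n) (Suc n)" "B \<in> carrier_mat n n"
    by (auto simp: A_def L_def B_def)
  have "det L = prod_list (diag_mat L)"
    by (rule det_lower_triangular[OF _ carr(2)]) (auto simp: L_def)
  also have "diag_mat L = map (\<lambda>_. 1) [0..<Suc n]"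
    unfolding diag_mat_def using carr(2) by (intro map_cong) (auto simp: L_def)
  finally have detL: "det L = 1" by (simp add: map_replicate_const)
  have entry: "(\<Sum>k = 0..<Suc n. L $$ (i, k) * A $$ (k, j)) = (if i = 0 then a i j else a i j - c * a (i - 1) j)"
    if ij: "i < Suc n" "j < Suc n" for i j
  proof -
    have "(\<Sum>k = 0..<Suc n. L $$ (i, k) * A $$ (k, j)) =
        (\<Sum>k = 0..<Suc n. (if k = i then a i j else 0) + (if Suc k = i then - c * a (i - 1) j else 0))"
      using ij by (intro sum.cong) (auto simp: L_def A_def)
    also have "\<dots> = a i j + (\<Sum>k = 0..<Suc n. if Suc k = i then - c * a (i - 1) j else 0)"
      using ij by (simp only: sum.distrib) simp
    also have "(\<Sum>k = 0..<Suc n. if Suc k = i then - c * a (i - 1) j else 0) =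
        (if i = 0 then 0 else - c * a (i - 1) j)"
    proof (cases i)
      case (Suc i')
      have "(\<Sum>k = 0..<Suc n. if Suc k = i then - c * a (i - 1) j else 0) =
        (\<Sum>k = 0..<Suc n. if k = i' then - c * a (i - 1) j else 0)"
        using Suc by (intro sum.cong) auto
      thus ?thesis using ij Suc by simp
    qed simp
    finally show ?thesis by auto
  qed
  have "L * A = four_block_mat (1\<^sub>m 1) (mat 1 n (\<lambda>(i, j). a 0 (Suc j))) (0\<^sub>m n 1) B"
  proof (rule eq_matI, goal_cases)
    case (1 i j)
    hence ij: "i < Suc n" "j < Suc n" by (auto simp: B_def)
    have "(L * A) $$ (i, j) = (\<Sum>k = 0..<Suc n. L $$ (i, k) * A $$ (k, j))"
      using ij carr by (auto simp: scalar_prod_def)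
    also note entry[OF ij]
    finally show ?case using ij assms
      by (cases i; cases j) (auto simp: B_def)
  qed (use carr in \<open>auto simp: B_def\<close>)
  hence "det (L * A) = det (1\<^sub>m 1 :: 'a mat) * det B"
    by (simp only:) (rule det_four_block_mat_lower_left_zero_col[OF _ _ refl carr(3)], auto)
  thus ?thesis
    using det_mult[OF carr(2,1)] detL by (simp add: A_def B_def)
qed

lemma det_leibniz_entries:
  fixes a :: "nat \<Rightarrow> nat \<Rightarrow> 'a :: comm_ring_1"
  shows "det (mat n n (\<lambda>(i, j). a i j)) =
    (\<Sum>p | p permutes {..<n}. signof p * (\<Prod>i<n. a i (p i)))"
proof -
  have "mat n n (\<lambda>(i, j). a i j) $$ (i, p i) = a i (p i)" if "p permutes {..<n}" "i < n" for p i
    using that permutes_in_image[of p "{..<n}" i] by simp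
  thus ?thesis
    by (simp add: det_def atLeast0LessThan)
qed

lemma det_scale_columns:
  fixes a :: "nat \<Rightarrow> nat \<Rightarrow> 'a :: comm_ring_1"
  shows "det (mat n n (\<lambda>(i, j). c j * a i j)) = (\<Prod>j<n. c j) * det (mat n n (\<lambda>(i, j). a i j))"
proof -
  have "(\<Prod>i<n. c (p i) * a i (p i)) = (\<Prod>j<n. c j) * (\<Prod>i<n. a i (p i))"
    if p: "p permutes {..<n}" for p
    using prod.permute[OF p, of c] by (simp add: prod.distrib o_def)
  thus ?thesis
    by (simp add: det_leibniz_entries sum_distrib_left mult.left_commute)
qed

lemma det_scale_rows:
  fixes a :: "nat \<Rightarrow> nat \<Rightarrow> 'a :: comm_ring_1"
  shows "det (mat n n (\<lambda>(i, j). c i * a i j)) = (\<Prod>i<n. c i) * det (mat n n (\<lambda>(i, j). a i j))"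
  by (simp add: det_leibniz_entries sum_distrib_left prod.distrib mult.left_commute)

lemma det_sum_rows:
  fixes a :: "nat \<Rightarrow> 'b \<Rightarrow> nat \<Rightarrow> 'a :: comm_ring_1"
  assumes "\<And>i. i < n \<Longrightarrow> finite (S i)"
  shows "det (mat n n (\<lambda>(i, j). \<Sum>m\<in>S i. a i m j)) =
    (\<Sum>f\<in>PiE {..<n} S. det (mat n n (\<lambda>(i, j). a i (f i) j)))"
proof -
  have "(\<Prod>i<n. \<Sum>m\<in>S i. a i m (p i)) = (\<Sum>f\<in>PiE {..<n} S. \<Prod>i<n. a i (f i) (p i))" for p
    by (rule prod_sum_PiE) (use assms in auto)
  thus ?thesis
    by (simp add: det_leibniz_entries sum_distrib_left) (rule sum.swap)
qed

lemma det_vandermonde: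
  fixes x :: "nat \<Rightarrow> 'a :: comm_ring_1"
  shows "det (mat n n (\<lambda>(j, i). x j ^ i)) = (\<Prod>j<n. \<Prod>i<j. x j - x i)"
proof -
  have "det (mat n n (\<lambda>(i, j). x j ^ i)) = (\<Prod>j<n. \<Prod>i<j. x j - x i)"
  proof (induction n arbitrary: x)
    case (Suc n)
    have "det (mat (Suc n) (Suc n) (\<lambda>(i, j). x j ^ i)) =
        det (mat n n (\<lambda>(i, j). x (Suc j) ^ Suc i - x 0 * x (Suc j) ^ i))"
      by (rule det_subtract_previous_rows) simp_all
    also have "\<dots> = det (mat n n (\<lambda>(i, j). (x (Suc j) - x 0) * x (Suc j) ^ i))"
      by (simp add: algebra_simps)
    also have "\<dots> = (\<Prod>j<n. x (Suc j) - x 0) * det (mat n n (\<lambda>(i, j). x (Suc j) ^ i))"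
      by (rule det_scale_columns)
    finally show ?case
      using Suc.IH[of "\<lambda>j. x (Suc j)"] by (simp add: prod_strict_pairs_shift del: prod.lessThan_Suc)
  qed simp
  moreover have "mat n n (\<lambda>(j, i). x j ^ i) = transpose_mat (mat n n (\<lambda>(i, j). x j ^ i))"
    by (rule eq_matI) auto
  ultimately show ?thesis by (simp add: det_transpose[of _ n])
qed

section \<open>Polynomials with nonnegative coefficients\<close>

definition nonneg_coeffs :: "real poly \<Rightarrow> bool" where
  "nonneg_coeffs p \<longleftrightarrow> (\<forall>i. coeff p i \<ge> 0)"

lemma nonneg_coeffs_mult: "nonneg_coeffs p \<Longrightarrow> nonneg_coeffs r \<Longrightarrow> nonneg_coeffs (p * r)"
  by (auto simp: nonneg_coeffs_def coeff_mult intro!: sum_nonneg)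

lemma nonneg_coeffs_sum: "(\<And>x. x \<in> A \<Longrightarrow> nonneg_coeffs (f x)) \<Longrightarrow> nonneg_coeffs (sum f A)"
  by (auto simp: nonneg_coeffs_def coeff_sum intro!: sum_nonneg)

lemma nonneg_coeffs_var_power_mult:
  "nonneg_coeffs ([:0, 1:] ^ m * p) \<longleftrightarrow> nonneg_coeffs p"
proof -
  have *: "[:0, 1:] ^ m = (monom 1 m :: real poly)" by (simp add: monom_altdef)
  show ?thesis
    unfolding nonneg_coeffs_def * coeff_monom_mult
    by (auto dest: spec[of _ "_ + m"])
qed

section \<open>Alternants and their branching rule\<close>

text \<open>
  For strictly increasing \<open>l\<close> this is, up to a factor not depending on \<open>l\<close>, the Schur polynomial
  of the partition with parts \<open>l j - j\<close>, evaluated at \<open>1, q, \<dots>, q\<^bsup>n - 1\<^esup>\<close>.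
\<close>

definition alternant :: "'a :: comm_ring_1 \<Rightarrow> nat \<Rightarrow> (nat \<Rightarrow> nat) \<Rightarrow> 'a" where
  "alternant q n l = det (mat n n (\<lambda>(j, i). (q ^ l j) ^ i))"

lemma alternant_eq: "alternant q n l = (\<Prod>j<n. \<Prod>i<j. q ^ l j - q ^ l i)"
  unfolding alternant_def by (rule det_vandermonde)

text \<open>
  The branching rule for Schur polynomials. The difference of rows \<open>j + 1\<close> and \<open>j\<close> in column
  \<open>i + 1\<close> telescopes over the exponents \<open>m\<close> from \<open>l j\<close> to \<open>l (j + 1) - 1\<close>, leaving the column
  factor \<open>q\<^bsup>i + 1\<^esup> - 1\<close> and, for each \<open>m\<close>, the row of a smaller alternant times \<open>q\<^bsup>m\<^esup>\<close>.
  Multilinearity then lets \<open>m\<close> vary independently in every row.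
\<close>

lemma alternant_branching:
  assumes "\<And>j. j < n \<Longrightarrow> l j \<le> l (Suc j)"
  shows "alternant q (Suc n) l = (\<Prod>i<n. q ^ Suc i - 1) *
    (\<Sum>f\<in>(\<Pi>\<^sub>E j\<in>{..<n}. {l j..<l (Suc j)}). q ^ (\<Sum>j<n. f j) * alternant q n f)"
proof -
  have tele: "(q ^ l (Suc j)) ^ Suc i - (q ^ l j) ^ Suc i =
      (q ^ Suc i - 1) * (\<Sum>m = l j..<l (Suc j). q ^ m * (q ^ m) ^ i)" if "j < n" for i j
  proof -
    have "(\<Sum>m = l j..<l (Suc j). (q ^ Suc i) ^ Suc m - (q ^ Suc i) ^ m) =
        (q ^ Suc i) ^ l (Suc j) - (q ^ Suc i) ^ l j"
      using assms[OF that] by (rule sum_Suc_diff')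
    moreover have "(q ^ Suc i) ^ Suc m - (q ^ Suc i) ^ m = (q ^ Suc i - 1) * (q ^ m * (q ^ m) ^ i)" for m
    proof -
      have "(q ^ Suc i) ^ m = q ^ m * (q ^ m) ^ i"
        by (metis power_Suc power_mult mult.commute)
      thus ?thesis by (simp add: algebra_simps)
    qed
    moreover have "(q ^ Suc i) ^ m = (q ^ m) ^ Suc i" for m
      by (metis power_mult mult.commute)
    ultimately show ?thesis
      by (simp only: sum_distrib_left)
  qed
  have "alternant q (Suc n) l = det (mat n n (\<lambda>(j, i). (q ^ l (Suc j)) ^ Suc i - 1 * (q ^ l j) ^ Suc i))"
    unfolding alternant_def by (rule det_subtract_previous_rows) simp_all
  also have "\<dots> = det (mat n n (\<lambda>(j, i). (q ^ Suc i - 1) * (\<Sum>m = l j..<l (Suc j). q ^ m * (q ^ m) ^ i)))"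
    by (intro arg_cong[of _ _ det] cong_mat) (simp_all only: tele mult_1 prod.case)
  also have "\<dots> = (\<Prod>i<n. q ^ Suc i - 1) * det (mat n n (\<lambda>(j, i). \<Sum>m = l j..<l (Suc j). q ^ m * (q ^ m) ^ i))"
    by (rule det_scale_columns)
  also have "det (mat n n (\<lambda>(j, i). \<Sum>m = l j..<l (Suc j). q ^ m * (q ^ m) ^ i)) =
      (\<Sum>f\<in>(\<Pi>\<^sub>E j\<in>{..<n}. {l j..<l (Suc j)}). det (mat n n (\<lambda>(j, i). q ^ f j * (q ^ f j) ^ i)))"
    by (rule det_sum_rows) simp
  also have "\<dots> = (\<Sum>f\<in>(\<Pi>\<^sub>E j\<in>{..<n}. {l j..<l (Suc j)}). q ^ (\<Sum>j<n. f j) * alternant q n f)"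
    by (simp only: det_scale_rows alternant_def power_sum)
  finally show ?thesis .
qed

text \<open>
  The induction works because a sequence interlacing a strictly increasing one is again strictly
  increasing, so that only such alternants occur in the branching rule and no signs arise.
\<close>

lemma alternant_quotient_nonneg:
  fixes l :: "nat \<Rightarrow> nat"
  defines "q \<equiv> [:0, 1:]"
  assumes "\<And>i j. i < j \<Longrightarrow> j < n \<Longrightarrow> l i < l j"
  shows "\<exists>p. nonneg_coeffs p \<and> alternant q n l = (\<Prod>m<n. \<Prod>i<m. q ^ Suc i - 1) * p"
  using assms(2)
proof (induction n arbitrary: l)
  case 0
  show ?case by (intro exI[of _ 1]) (simp add: nonneg_coeffs_def alternant_eq)
next
  case (Suc n)
  let ?F = "\<Pi>\<^sub>E j\<in>{..<n}. {l j..<l (Suc j)}"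
  have "\<forall>f\<in>?F. \<exists>p. nonneg_coeffs p \<and> alternant q n f = (\<Prod>m<n. \<Prod>i<m. q ^ Suc i - 1) * p"
  proof (intro ballI Suc.IH)
    fix f i j assume f: "f \<in> ?F" and ij: "i < j" "j < n"
    have "f i < l (Suc i)" "l j \<le> f j" using f ij by (auto simp: PiE_iff)
    moreover have "l (Suc i) \<le> l j"
      using Suc.prems[of "Suc i" j] ij by (cases "Suc i = j") auto
    ultimately show "f i < f j" by linarith
  qed
  from bchoice[OF this] obtain p where p: "\<And>f. f \<in> ?F \<Longrightarrow> nonneg_coeffs (p f)"
      "\<And>f. f \<in> ?F \<Longrightarrow> alternant q n f = (\<Prod>m<n. \<Prod>i<m. q ^ Suc i - 1) * p f"
    by blast
  have "alternant q (Suc n) l = (\<Prod>i<n. q ^ Suc i - 1) *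
      (\<Sum>f\<in>?F. q ^ (\<Sum>j<n. f j) * alternant q n f)"
    using Suc.prems by (intro alternant_branching) (simp add: less_imp_le)
  also have "(\<Sum>f\<in>?F. q ^ (\<Sum>j<n. f j) * alternant q n f) =
      (\<Prod>m<n. \<Prod>i<m. q ^ Suc i - 1) * (\<Sum>f\<in>?F. q ^ (\<Sum>j<n. f j) * p f)"
    unfolding sum_distrib_left by (intro sum.cong) (simp_all only: p(2) mult_ac)
  finally have "alternant q (Suc n) l = (\<Prod>m<Suc n. \<Prod>i<m. q ^ Suc i - 1) *
      (\<Sum>f\<in>?F. q ^ (\<Sum>j<n. f j) * p f)"
    by (simp only: prod.lessThan_Suc mult_ac)
  moreover have "nonneg_coeffs (\<Sum>f\<in>?F. q ^ (\<Sum>j<n. f j) * p f)"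
    using p(1) unfolding q_def by (intro nonneg_coeffs_sum) (simp only: nonneg_coeffs_var_power_mult)
  ultimately show ?case by blast
qed

section \<open>Hoggatt polynomials as quotients of alternants\<close>

text \<open>
  The exponents whose excess over \<open>0, 1, 2, \<dots>\<close> is \<open>0\<close> in the first \<open>a\<close> places and \<open>d\<close> in all others:
  with \<open>k\<close> places after the gap, they describe the rectangular partition of \<open>k\<close> parts \<open>d\<close>.
\<close>

definition gap_exponents :: "nat \<Rightarrow> nat \<Rightarrow> nat \<Rightarrow> nat" where
  "gap_exponents a d j = (if j < a then j else j + d)"

lemma prod_lessThan_add:
  fixes f :: "nat \<Rightarrow> 'a :: comm_monoid_mult"
  shows "(\<Prod>i<a + k. f i) = (\<Prod>i<a. f i) * (\<Prod>i<k. f (a + i))"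
  by (induction k) (simp_all add: mult.assoc)

text \<open>
  The factor for \<open>i = 0\<close> on the left is \<open>q\<^bsup>a + c + 1\<^esup> - 1\<close>; the remaining ones are \<open>q\<close> times
  the factors on the right, where the last one, \<open>q\<^bsup>a - 1\<^esup> (q\<^bsup>c + 1\<^esup> - 1)\<close>, is left over.
\<close>

lemma prod_power_diff_shift:
  fixes q :: "'a :: comm_ring_1"
  shows "(\<Prod>i<a. q ^ Suc (a + c) - q ^ i) * (1 - q ^ Suc c) =
    (1 - q ^ Suc (a + c)) * (\<Prod>i<a. q ^ (a + c) - q ^ i)"
proof (cases a)
  case (Suc b)
  have "(\<Prod>i<Suc b. q ^ Suc (a + c) - q ^ i) =
      (q ^ Suc (a + c) - 1) * (\<Prod>i<b. q * (q ^ (a + c) - q ^ i))"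
    by (simp add: prod.lessThan_Suc_shift algebra_simps del: prod.lessThan_Suc)
  also have "\<dots> = (q ^ Suc (a + c) - 1) * q ^ b * (\<Prod>i<b. q ^ (a + c) - q ^ i)"
    by (simp add: prod.distrib mult.assoc)
  finally have 1: "(\<Prod>i<Suc b. q ^ Suc (a + c) - q ^ i) = \<dots>" .
  have 2: "q ^ (a + c) - q ^ b = q ^ b * (q ^ Suc c - 1)"
    unfolding Suc by (simp add: algebra_simps power_add)
  show ?thesis
    unfolding Suc prod.lessThan_Suc[of "\<lambda>i. q ^ (Suc b + c) - q ^ i"]
      1[unfolded Suc] 2[unfolded Suc]
    by (simp add: algebra_simps)
qed simp

text \<open>
  Widening the gap by one multiplies the factors of the Vandermonde product inside the upper block by \<open>q\<close>
  each, which accounts for the power of \<open>q\<close>, and leaves those inside the lower block alone. The factors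
  between the blocks change, one upper exponent at a time, as in \<open>prod_power_diff_shift\<close>.
\<close>

lemma alternant_gap_Suc:
  fixes q :: "'a :: comm_ring_1"
  shows "alternant q (a + k) (gap_exponents a (Suc d)) * (\<Prod>i=1..k. 1 - q ^ (d + i)) =
    q ^ (k choose 2) * (\<Prod>i=1..k. 1 - q ^ (a + d + i)) * alternant q (a + k) (gap_exponents a d)"
proof (induction k)
  case 0
  show ?case by (auto simp: alternant_eq gap_exponents_def numeral_2_eq_2 intro!: prod.cong)
next
  case (Suc k)
  \<comment> \<open>the factors that the last row contributes to the Vandermonde product\<close>
  define E where "E d = (\<Prod>i<a + k. q ^ (a + k + d) - q ^ gap_exponents a d i)" for d
  have E: "E d = (\<Prod>i<a. q ^ (a + (k + d)) - q ^ i) * (\<Prod>i<k. q ^ (a + k + d) - q ^ (a + i + d))" for d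
    by (simp add: E_def prod_lessThan_add gap_exponents_def add.assoc)
  have "(\<Prod>i<k. q ^ (a + k + Suc d) - q ^ (a + i + Suc d)) =
      (\<Prod>i<k. q * (q ^ (a + k + d) - q ^ (a + i + d)))"
    by (simp add: algebra_simps)
  also have "\<dots> = q ^ k * (\<Prod>i<k. q ^ (a + k + d) - q ^ (a + i + d))"
    by (simp add: prod.distrib)
  finally have top: "(\<Prod>i<k. q ^ (a + k + Suc d) - q ^ (a + i + Suc d)) = \<dots>" .
  have "E (Suc d) * (1 - q ^ Suc (k + d)) =
      ((\<Prod>i<a. q ^ Suc (a + (k + d)) - q ^ i) * (1 - q ^ Suc (k + d))) *
      (q ^ k * (\<Prod>i<k. q ^ (a + k + d) - q ^ (a + i + d)))"
    unfolding E top by (simp only: add_Suc_right mult_ac)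
  also have "\<dots> = q ^ k * (1 - q ^ Suc (a + (k + d))) * E d"
    unfolding E prod_power_diff_shift by (simp only: mult_ac)
  finally have E_step: "E (Suc d) * (1 - q ^ Suc (k + d)) = q ^ k * (1 - q ^ Suc (a + (k + d))) * E d" .
  have split: "alternant q (a + Suc k) (gap_exponents a d) =
      alternant q (a + k) (gap_exponents a d) * E d" for d
    by (simp add: alternant_eq E_def gap_exponents_def)
  have "alternant q (a + Suc k) (gap_exponents a (Suc d)) * (\<Prod>i=1..Suc k. 1 - q ^ (d + i)) =
      (alternant q (a + k) (gap_exponents a (Suc d)) * (\<Prod>i=1..k. 1 - q ^ (d + i))) *
      (E (Suc d) * (1 - q ^ Suc (k + d)))"
    unfolding split by (simp add: mult_ac add_ac)
  also have "\<dots> = q ^ ((k choose 2) + k) * (\<Prod>i=1..Suc k. 1 - q ^ (a + d + i)) *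
      (alternant q (a + k) (gap_exponents a d) * E d)"
    unfolding Suc.IH E_step by (simp add: power_add mult_ac add_ac)
  also have "(k choose 2) + k = Suc k choose 2"
    by (simp add: numeral_2_eq_2)
  finally show ?case by (simp only: split)
qed

lemma alternant_gap:
  fixes q :: "'a :: comm_ring_1"
  shows "alternant q (a + k) (gap_exponents a d) * (\<Prod>j<d. \<Prod>i=1..k. 1 - q ^ (j + i)) =
    q ^ (d * (k choose 2)) * (\<Prod>j<d. \<Prod>i=1..k. 1 - q ^ (a + j + i)) * alternant q (a + k) (\<lambda>j. j)"
proof (induction d)
  case 0
  have "gap_exponents a 0 = (\<lambda>j. j)" by (auto simp: gap_exponents_def)
  thus ?case by simp
next
  case (Suc d)
  have "alternant q (a + k) (gap_exponents a (Suc d)) * (\<Prod>j<Suc d. \<Prod>i=1..k. 1 - q ^ (j + i)) =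
      (alternant q (a + k) (gap_exponents a (Suc d)) * (\<Prod>i=1..k. 1 - q ^ (d + i))) *
      (\<Prod>j<d. \<Prod>i=1..k. 1 - q ^ (j + i))"
    by (simp only: prod.lessThan_Suc mult_ac)
  also have "\<dots> = q ^ (k choose 2) * (\<Prod>i=1..k. 1 - q ^ (a + d + i)) *
      (alternant q (a + k) (gap_exponents a d) * (\<Prod>j<d. \<Prod>i=1..k. 1 - q ^ (j + i)))"
    by (simp only: alternant_gap_Suc mult_ac)
  also have "\<dots> = q ^ (Suc d * (k choose 2)) * (\<Prod>j<Suc d. \<Prod>i=1..k. 1 - q ^ (a + j + i)) *
      alternant q (a + k) (\<lambda>j. j)"
    unfolding Suc.IH by (simp only: prod.lessThan_Suc mult_Suc power_add mult_ac)
  finally show ?case .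
qed

text \<open>
  This identifies the factor in \<open>alternant_quotient_nonneg\<close>: up to a power of \<open>q\<close>, it is the
  alternant of the empty partition.
\<close>

lemma alternant_consecutive:
  fixes q :: "'a :: comm_ring_1"
  shows "alternant q n (\<lambda>j. j) = q ^ (\<Sum>j<n. \<Sum>i<j. i) * (\<Prod>j<n. \<Prod>i<j. q ^ Suc i - 1)"
proof -
  have "(\<Prod>i<j. q ^ j - q ^ i) = q ^ (\<Sum>i<j. i) * (\<Prod>i<j. q ^ Suc i - 1)" for j
  proof -
    have "(\<Prod>i<j. q ^ j - q ^ i) = (\<Prod>i<j. q ^ i * (q ^ Suc (j - Suc i) - 1))"
      by (intro prod.cong) (simp_all add: algebra_simps Suc_diff_Suc flip: power_add power_Suc)
    thus ?thesis
      by (simp only: prod.distrib power_sum prod.nat_diff_reindex[of "\<lambda>i. q ^ Suc i - 1"])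
  qed
  thus ?thesis by (simp only: alternant_eq prod.distrib power_sum)
qed

lemma hoggatt_exponent: "d * k * (k - 1) div 2 = d * (k choose 2)"
proof -
  have "even (k * (k - 1))" by (cases k) auto
  thus ?thesis by (simp only: choose_two div_mult_swap mult.assoc)
qed

lemma hoggatt_alternant:
  "hoggatt d (a + k) k * alternant [:0, 1:] (a + k) (\<lambda>j. j) =
    alternant [:0, 1:] (a + k) (gap_exponents a d)"
proof -
  define D where "D = (\<Prod>j<d. \<Prod>i=1..k. xpoly (j + i))"
  define N where "N = (\<Prod>j<d. \<Prod>i=1..k. xpoly (a + j + i))"
  have D: "D \<noteq> 0" by (auto simp: D_def xpoly_nz)
  have "to_fract (hoggatt d (a + k) k) = to_fract ([:0, 1:] ^ (d * (k choose 2))) * (to_fract N / to_fract D)"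
    using hoggatt_fract_eq[of k "a + k" d]
    unfolding hoggatt_exponent by (simp add: to_fract_hoggatt N_def D_def qvar_def to_fract_power)
  hence "to_fract (hoggatt d (a + k) k * D) = to_fract ([:0, 1:] ^ (d * (k choose 2)) * N)"
    using D by simp
  hence "hoggatt d (a + k) k * D = [:0, 1:] ^ (d * (k choose 2)) * N"
    by (simp only: to_fract_eq_iff)
  hence "hoggatt d (a + k) k * alternant [:0, 1:] (a + k) (\<lambda>j. j) * D =
      [:0, 1:] ^ (d * (k choose 2)) * N * alternant [:0, 1:] (a + k) (\<lambda>j. j)"
    by (metis mult.assoc mult.commute)
  also have "\<dots> = alternant [:0, 1:] (a + k) (gap_exponents a d) * D"
    unfolding D_def N_def xpoly_def alternant_gap ..
  finally show ?thesis using D by (simp only: mult_cancel_right) simp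
qed

text \<open>
  Both the alternant with a gap and the one without are multiples of the same nonzero \<open>V\<close>, with cofactors
  a polynomial \<open>p\<close> with nonnegative coefficients and a power of \<open>q\<close>. Cancelling \<open>V\<close> shows that \<open>p\<close> is
  the Hoggatt polynomial shifted by that power.
\<close>

theorem nonneg_coeffs_hoggatt:
  assumes "k \<le> n"
  shows "nonneg_coeffs (hoggatt d n k)"
proof -
  define a where "a = n - k"
  have n: "n = a + k" using assms by (simp add: a_def)
  define V :: "real poly" where "V = (\<Prod>m<n. \<Prod>i<m. [:0, 1:] ^ Suc i - 1)"
  define c where "c = (\<Sum>j<n. \<Sum>i<j. i)"
  have "V \<noteq> 0"
  proof -
    have "[:0, 1:] ^ Suc i - 1 \<noteq> (0 :: real poly)" for i
      using xpoly_nz[of "Suc i"] unfolding xpoly_def by (metis eq_iff_diff_eq_0 zero_less_Suc)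
    thus ?thesis by (auto simp: V_def simp del: power_Suc)
  qed
  have "gap_exponents a d i < gap_exponents a d j" if "i < j" for i j
    using that by (auto simp: gap_exponents_def)
  then obtain p where p: "nonneg_coeffs p" "alternant [:0, 1:] n (gap_exponents a d) = V * p"
    using alternant_quotient_nonneg[of n "gap_exponents a d"] unfolding V_def by blast
  have "V * p = V * ([:0, 1:] ^ c * hoggatt d n k)"
    using hoggatt_alternant[of d a k] p(2) alternant_consecutive[of "[:0, 1:] :: real poly" n]
    unfolding n[symmetric] V_def[symmetric] c_def[symmetric] by (simp only: mult_ac)
  hence "p = [:0, 1:] ^ c * hoggatt d n k"
    using \<open>V \<noteq> 0\<close> by (simp only: mult_cancel_left) simp
  thus ?thesis using p(1) by (simp only: nonneg_coeffs_var_power_mult)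
qed

section \<open>The quadratic relation between Hoggatt polynomials\<close>

lemma qbinom_Suc_left:
  assumes "k \<le> N"
  shows "qbinom (Suc N) k = qbinom N k * (qint (Suc N) / qint (Suc N - k))"
  using assms by (simp add: qbinom_def qfact_def Suc_diff_le)

lemma qbinom_Suc_right:
  assumes "k < N"
  shows "qbinom N (Suc k) = qbinom N k * (qint (N - k) / qint (Suc k))"
proof -
  have "N - k = Suc (N - Suc k)" using assms by simp
  hence "qfact (N - k) = qfact (N - Suc k) * qint (N - k)"
    by (simp add: qfact_def)
  thus ?thesis
    using assms qint_nz[of "N - k"] by (simp add: qbinom_def qfact_def)
qed

lemma qbinom_Suc_Suc:
  assumes "k \<le> N"
  shows "qbinom (Suc N) (Suc k) = qbinom N k * (qint (Suc N) / qint (Suc k))"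
  using assms by (simp add: qbinom_def qfact_def)

lemma hoggatt_fract_Suc_dim:
  "hoggatt_fract (Suc d) n k =
    hoggatt_fract d n k * (qvar ^ (k choose 2) * (qbinom (n + d) k / qbinom (k + d) k))"
  unfolding hoggatt_fract_def hoggatt_exponent
  unfolding mult_Suc power_add prod.atLeast0_lessThan_Suc
  by (simp only: mult_ac)

lemma hoggatt_fract_Suc_index:
  assumes "k < n"
  shows "hoggatt_fract d n (Suc k) =
    hoggatt_fract d n k * (qvar ^ (d * k) * (\<Prod>j<d. qint (n - k + j) / qint (Suc k + j)))"
proof -
  have "qbinom (n + j) (Suc k) / qbinom (Suc k + j) (Suc k) =
      qbinom (n + j) k / qbinom (k + j) k * (qint (n - k + j) / qint (Suc k + j))" for j
    using assms qbinom_Suc_right[of k "n + j"] qbinom_Suc_Suc[of k "k + j"] qint_nz[of "Suc k"]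
    by (simp add: mult_ac)
  moreover have "Suc k choose 2 = (k choose 2) + k"
    by (simp add: numeral_2_eq_2)
  ultimately show ?thesis
    unfolding hoggatt_fract_def hoggatt_exponent
    by (simp only: distrib_left power_add prod.distrib atLeast0LessThan mult_ac)
qed

text \<open>
  Passing from \<open>d\<close> to \<open>d + 1\<close> multiplies by one quotient of \<open>q\<close>-binomials, so this second-order
  ratio is the ratio of two consecutive such quotients.
\<close>

lemma hoggatt_fract_dim_ratio:
  assumes "k \<le> n"
  shows "hoggatt_fract d n k * hoggatt_fract (Suc (Suc d)) n k =
    hoggatt_fract (Suc d) n k ^ 2 *
      (qint (n + Suc d) * qint (Suc d) / (qint (n - k + Suc d) * qint (k + Suc d)))"
proof -
  have "Suc (n + d) - k = n - k + Suc d" using assms by simp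
  hence "qbinom (n + Suc d) k / qbinom (k + Suc d) k = qbinom (n + d) k / qbinom (k + d) k *
      (qint (n + Suc d) * qint (Suc d) / (qint (n - k + Suc d) * qint (k + Suc d)))"
    using assms qbinom_Suc_left[of k "n + d"] qbinom_Suc_left[of k "k + d"] qint_nz[of "Suc d"]
    by (simp add: mult_ac)
  thus ?thesis
    unfolding hoggatt_fract_Suc_dim[of "Suc d"] hoggatt_fract_Suc_dim[of d]
    by (simp only: power2_eq_square mult_ac)
qed

text \<open>
  By \<open>hoggatt_fract_Suc_index\<close> the second-order ratio in \<open>k\<close> is a quotient of two products over
  \<open>j < d\<close>. Their indices differ by a shift of one, so the quotient telescopes to its boundary terms.
\<close>

lemma hoggatt_fract_index_ratio:
  assumes "Suc k < n"
  shows "hoggatt_fract d n k * hoggatt_fract d n (Suc (Suc k)) =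
    hoggatt_fract d n (Suc k) ^ 2 *
      (qvar ^ d * qint (n - Suc k) * qint (Suc k) / (qint (n - Suc k + d) * qint (Suc k + d)))"
proof -
  define m where "m = n - Suc k"
  have m: "m > 0" "n - k = Suc m" using assms by (auto simp: m_def)
  have "(\<Prod>j<d. qint (m + j) / qint (Suc (Suc k) + j)) =
      (\<Prod>j<d. qint (Suc m + j) / qint (Suc k + j)) * (qint m * qint (Suc k) / (qint (m + d) * qint (Suc k + d)))"
  proof (induction d)
    case 0
    show ?case using m by (simp add: qint_nz)
  next
    case (Suc d)
    show ?case
      unfolding prod.lessThan_Suc Suc.IH using m by (simp add: qint_nz field_simps)
  qed
  hence "qvar ^ (d * Suc k) * (\<Prod>j<d. qint (n - Suc k + j) / qint (Suc (Suc k) + j)) =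
    qvar ^ (d * k) * (\<Prod>j<d. qint (n - k + j) / qint (Suc k + j)) *
      (qvar ^ d * qint (n - Suc k) * qint (Suc k) / (qint (n - Suc k + d) * qint (Suc k + d)))"
    unfolding m(2) m_def[symmetric] by (simp add: power_add mult_ac)
  thus ?thesis
    using hoggatt_fract_Suc_index[of k n d] hoggatt_fract_Suc_index[of "Suc k" n d] assms
    by (simp only: power2_eq_square mult_ac)
qed

text \<open>
  Cleared of denominators, this says that \<open>(1 - x z) (1 - y z) = (1 - x y z) (1 - z) + z (1 - x) (1 - y)\<close>
  for \<open>x = q\<^sup>a\<close>, \<open>y = q\<^sup>k\<close>, \<open>z = q\<^sup>d\<close>.
\<close>

lemma qint_identity:
  "qint (a + k + d) * qint d + qvar ^ d * qint a * qint k = qint (a + d) * qint (k + d)"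
proof -
  let ?u = "\<lambda>m. 1 - qvar ^ m" and ?c = "1 - qvar"
  have "qint (a + k + d) * qint d + qvar ^ d * qint a * qint k =
      (?u (a + k + d) * ?u d + qvar ^ d * ?u a * ?u k) / (?c * ?c)"
    by (simp add: qint_def add_divide_distrib)
  also have "?u (a + k + d) * ?u d + qvar ^ d * ?u a * ?u k = ?u (a + d) * ?u (k + d)"
    by (simp add: algebra_simps power_add)
  finally show ?thesis by (simp add: qint_def)
qed

text \<open>
  The two second-order ratios, in \<open>d\<close> and in \<open>k\<close>, have the same denominator, and by
  \<open>qint_identity\<close> they add up to \<open>1\<close>. This is the octahedron recurrence for Schur functions of
  rectangular shape.
\<close>

theorem hoggatt_octahedron:
  assumes "Suc k < n"
  shows "hoggatt (Suc d) n (Suc k) ^ 2 - hoggatt (Suc d) n k * hoggatt (Suc d) n (Suc (Suc k)) =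
    hoggatt d n (Suc k) * hoggatt (Suc (Suc d)) n (Suc k)"
proof -
  define m where "m = n - Suc k"
  have n: "n = m + Suc k" using assms by (simp add: m_def)
  let ?h = "hoggatt_fract (Suc d) n (Suc k)"
  let ?D = "qint (m + Suc d) * qint (Suc k + Suc d)"
  have "qint (n + Suc d) * qint (Suc d) / ?D + qvar ^ Suc d * qint m * qint (Suc k) / ?D = 1"
    using qint_identity[of m "Suc k" "Suc d"] unfolding n
    by (simp add: qint_nz flip: add_divide_distrib)
  hence "?h ^ 2 = ?h ^ 2 * (qint (n + Suc d) * qint (Suc d) / ?D) +
      ?h ^ 2 * (qvar ^ Suc d * qint m * qint (Suc k) / ?D)"
    by (metis distrib_left mult.right_neutral)
  also have "\<dots> = hoggatt_fract d n (Suc k) * hoggatt_fract (Suc (Suc d)) n (Suc k) +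
      hoggatt_fract (Suc d) n k * hoggatt_fract (Suc d) n (Suc (Suc k))"
    using assms by (simp only: hoggatt_fract_dim_ratio hoggatt_fract_index_ratio m_def less_imp_le)
  finally have "to_fract (hoggatt (Suc d) n (Suc k) ^ 2 -
      hoggatt (Suc d) n k * hoggatt (Suc d) n (Suc (Suc k))) =
    to_fract (hoggatt d n (Suc k) * hoggatt (Suc (Suc d)) n (Suc k))"
    using assms by (simp add: to_fract_hoggatt to_fract_power)
  thus ?thesis by (simp only: to_fract_eq_iff)
qed

theorem theorem6p6:
  fixes d n :: nat
  assumes "d \<ge> 1"
  shows "q_log_concave n (\<lambda>k. hoggatt d n k)"
  unfolding q_log_concave_def
proof (intro allI impI)
  fix k i assume k: "1 \<le> k \<and> k < n"
  obtain e where d: "d = Suc e" using assms by (cases d) auto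
  obtain l where l: "k = Suc l" using k by (cases k) auto
  have "nonneg_coeffs (hoggatt e n k * hoggatt (Suc d) n k)"
    using k by (intro nonneg_coeffs_mult nonneg_coeffs_hoggatt) auto
  thus "coeff (hoggatt d n k ^ 2 - hoggatt d n (k - 1) * hoggatt d n (k + 1)) i \<ge> 0"
    using hoggatt_octahedron[of l n e] k by (simp add: d l nonneg_coeffs_def)
qed

end
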